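(* Let $r\ge1$ be an integer and let $\bar T^n_{h,(r)}$ be the $r$-th order transport operator defined on particles by $$\bar T^n_{h,(r)}\varphi^0_{h,k}(x):=\chi_{\tilde\Sigma^n_{h,k}}(x)\,\varphi^0_{h,k}\big(\bar B^n_{(r),k}(x)\big),$$ where $\chi$ denotes the characteristic function of a set, and the polynomial mappings $\bar B^n_{(r),k}$ and the sets $\tilde\Sigma^n_{h,k}$ are defined in the context. Then $$\|(\bar T^n_{h,(r)}-\bar T^n_{\rm ex})A_hf^0\|_{L^\infty}\le C\,h^r\,\tilde c^n_{F,(r)}\,\big(1+h\,\tilde c^n_{F,(1)}\big)^d\,\|f^0\|_{L^\infty}$$ with a constant $C$ independent of $h$, $f^0$, $u$ and $n$, where for every integer $s\ge1$ $$\tilde c^n_{F,(s)}:=\big(\tilde\rho^n|\bar F^n_{\rm ex}|_1\big)^{s+1}|\bar B^n_{\rm ex}|_{s+1},\qquad \tilde\rho^n:=\rho^0\Big(1+\frac{h\rho^0}{2}|\bar F^n_{\rm ex}|_1^2\,|\bar B^n_{\rm ex}|_2\Big).$$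
   Context: **Flow.** Let $d\ge 1$, $T>0$, $\Delta t>0$, and let $u:[0,T]\times\mathbb{R}^d\to\mathbb{R}^d$ be a velocity field with $\operatorname{div} u=0$, smooth enough that the characteristic trajectories $X'(t)=u(t,X(t))$, $X(t_0)=x_0$ are defined on $[0,T]$ for all $t_0\in[0,T]$, $x_0\in\mathbb{R}^d$. The characteristic flow is $F_{t_0,t}:x_0\mapsto X(t)$; it is invertible with $(F_{t_0,t})^{-1}=F_{t,t_0}$, and $\det J_{F_{t_0,t}}=1$, where $J_F=(\partial_j F_i)_{1\le i,j\le d}$ denotes the Jacobian matrix. For $t^n=n\Delta t\in[0,T]$ set $\bar F^n_{\rm ex}:=F_{0,t^n}$ and $\bar B^n_{\rm ex}:=(\bar F^n_{\rm ex})^{-1}$. The velocity is assumed smooth enough for the derivatives and semi-norms appearing here to be well defined. The exact transport operator is $\bar T^n_{\rm ex}g := g\circ \bar B^n_{\rm ex}$. **Norms.** $\|x\|_\infty=\max_i|x_i|$ on $\mathbb{R}^d$, $B_{\ell^\infty}(x,\rho)$ is the closed $\|\cdot\|_\infty$-ball of center $x$ and radius $\rho$; for a vector-valued function, $\|v\|_{L^\infty(\omega)}$ is the sup over $\omega$ of $\|v(x)\|_\infty$. For $\omega\subset\mathbb{R}^d$ and an integer $m>0$, $$|v|_{m,\omega}:=\max_i\Big\{\sum_{l_1=1}^d\cdots\sum_{l_m=1}^d\|\partial_{l_1}\cdots\partial_{l_m}v_i\|_{L^\infty(\omega)}\Big\},\qquad |v|_m:=|v|_{m,\mathbb{R}^d}.$$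 **Particles.** Let $h>0$, $x^0_k:=hk$ for $k\in\mathbb{Z}^d$, and for a reference shape function $\varphi:\mathbb{R}^d\to\mathbb{R}$ supported in $B_{\ell^\infty}(0,\rho^0)$ put $\varphi_h:=h^{-d}\varphi(h^{-1}\,\cdot)$, $\varphi^0_{h,k}(x):=\varphi_h(x-x^0_k)=h^{-d}\varphi(h^{-1}x-k)$ and $\Sigma^0_{h,k}:=\operatorname{supp}(\varphi^0_{h,k})\subset B_{\ell^\infty}(x^0_k,h\rho^0)$. Operators on particles are extended linearly to sums $\sum_k w_k\varphi^0_{h,k}$. **Approximate backward flows.** For $k\in\mathbb{Z}^d$ and $x\in\mathbb{R}^d$ let $\phi_k(s)=\phi_k(s;x):=(\bar B^n_{\rm ex}-I)\big(\bar F^n_{\rm ex}(x^0_k)+s(x-\bar F^n_{\rm ex}(x^0_k))\big)$, with $I$ the identity map, and $$\bar B^n_{(r),k}(x):=x-\bar F^n_{\rm ex}(x^0_k)+x^0_k+\phi_k'(0)+\cdots+\frac1{r!}\phi_k^{(r)}(0)$$ (i.e. the degree-$r$ Taylor polynomial of $\bar B^n_{\rm ex}$ at $\bar F^n_{\rm ex}(x^0_k)$). In particular $\bar B^n_{(1),k}(x)=x^0_k+(J^n_k)^{-1}(x-\bar F^n_{\rm ex}(x^0_k))$ with $J^n_k:=J_{\bar F^n_{\rm ex}}(x^0_k)$, whose inverse is $\bar F^n_{(1),k}(\hat x)=\bar F^n_{\rm ex}(x^0_k)+J^n_k(\hat x-x^0_k)$. **A priori supports.** $$\tilde\Sigma^n_{h,k}:=\bar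 F^n_{(1),k}\big(B_{\ell^\infty}(x^0_k,h\tilde\rho^n_{h,k})\big),\qquad \tilde\rho^n_{h,k}:=\rho^0+\frac1h\|\bar B^n_{(1),k}-\bar B^n_{\rm ex}\|_{L^\infty(\bar F^n_{\rm ex}(\Sigma^0_{h,k}))}.$$ **Shape function and approximation operator.** $f^0:\mathbb{R}^d\to\mathbb{R}$ is a bounded initial datum, defined pointwise, with $\|f^0\|_{L^\infty}=\sup|f^0|$. The pair $(\varphi,A_h)$ is one of the following, fixed once and for all (the constant $C$ may depend on this choice, on $d$ and on $r$). (i) B-splines of degree $p\ge1$: $\mathcal{B}_0:=\chi_{[-1/2,1/2]}$, $\mathcal{B}_p:=\mathcal{B}_{p-1}*\mathcal{B}_0$, $\varphi(x):=\prod_{i=1}^d\mathcal{B}_p(x_i)$, $\rho^0:=\frac{p+1}{2}$, and $$A_h g:=\sum_{k\in\mathbb{Z}^d}w_k(g)\varphi^0_{h,k},\qquad w_k(g):=h^d\sum_{l\in\mathbb{Z}^d,\ \|l\|_\infty\le m_p}a_l\,g(x^0_{k+l}),\qquad a_l:=\prod_{i=1}^d a_{l_i},$$ where $m_p\ge0$ and the symmetric real coefficients $a_{l_i}=a_{-l_i}$ are those of the Chui–Diamond quasi-interpolation scheme: they depend only on $p$ and make $A_h$ reproduce the polynomials of coordinate degree $\le p$. For instance $m_1=0$, $a_0=1$ for $p=1$; $m_3=1$, $(a_0,a_1)=(\frac86,-\frac16)$ for $p=3$; $m_5=4$, $(a_0,\dots,a_4)=(\frac{503}{288},-\frac{1469}{3600},\frac{7}{225},\frac{13}{3600},\frac1{14400})$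 for $p=5$. (ii) $M'_4$ particles: $\varphi(x)=\prod_{i=1}^d M'_4(x_i)$ with $M'_4(s)=1-\frac52|s|^2+\frac32|s|^3$ for $0\le|s|\le1$, $M'_4(s)=\frac12(2-|s|)^2(1-|s|)$ for $1\le|s|\le2$, and $M'_4(s)=0$ otherwise, $\rho^0:=2$, and $A_h g:=\sum_k w_k(g)\varphi^0_{h,k}$ with $w_k(g):=h^d g(x^0_k)$. *)

theory Defs
  imports "HOL-Analysis.Analysis"
begin

section \<open>Partial derivatives, norms and semi-norms\<close>

text \<open>
  The supremum is taken in \<^typ>\<open>real\<close>, so the value is meaningful only for \<open>v\<close> bounded
  on a nonempty \<open>\<omega>\<close>. For scalar \<open>v\<close>, \<^const>\<open>infnorm\<close> is the absolute value.
\<close>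

definition linf_norm :: "'a set \<Rightarrow> ('a \<Rightarrow> 'b::euclidean_space) \<Rightarrow> real" where
  "linf_norm \<omega> v = (SUP x\<in>\<omega>. infnorm (v x))"

definition linf_cball :: "real^'d \<Rightarrow> real \<Rightarrow> (real^'d) set" where
  "linf_cball x \<rho> = {y. infnorm (y - x) \<le> \<rho>}"

definition partial_deriv :: "'d \<Rightarrow> (real^'d \<Rightarrow> real) \<Rightarrow> real^'d \<Rightarrow> real" where
  "partial_deriv j g x = deriv (\<lambda>s. g (x + s *\<^sub>R axis j 1)) 0"

definition iter_partial :: "'d list \<Rightarrow> (real^'d \<Rightarrow> real) \<Rightarrow> real^'d \<Rightarrow> real" where
  "iter_partial ls g = foldr partial_deriv ls g"

fun cont_diff :: "nat \<Rightarrow> (real^'d \<Rightarrow> real) \<Rightarrow> bool" where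
  "cont_diff 0 g \<longleftrightarrow> continuous_on UNIV g"
| "cont_diff (Suc m) g \<longleftrightarrow> g differentiable_on UNIV \<and> (\<forall>j. cont_diff m (partial_deriv j g))"

definition cont_diff_map :: "nat \<Rightarrow> (real^'d \<Rightarrow> real^'d) \<Rightarrow> bool" where
  "cont_diff_map m v \<longleftrightarrow> (\<forall>i. cont_diff m (\<lambda>x. v x $ i))"

definition seminorm :: "nat \<Rightarrow> (real^'d) set \<Rightarrow> (real^'d \<Rightarrow> real^'d) \<Rightarrow> real" where
  "seminorm m \<omega> v =
     Max (range (\<lambda>i. \<Sum>ls | length ls = m. linf_norm \<omega> (iter_partial ls (\<lambda>x. v x $ i))))"

definition finite_seminorm :: "nat \<Rightarrow> (real^'d) set \<Rightarrow> (real^'d \<Rightarrow> real^'d) \<Rightarrow> bool" where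
  "finite_seminorm m \<omega> v \<longleftrightarrow>
     (\<forall>i ls. length ls = m \<longrightarrow> bounded (iter_partial ls (\<lambda>x. v x $ i) ` \<omega>))"

section \<open>Characteristic flow\<close>

definition characteristic ::
  "(real \<Rightarrow> real^'d \<Rightarrow> real^'d) \<Rightarrow> real \<Rightarrow> real \<Rightarrow> real^'d \<Rightarrow> (real \<Rightarrow> real^'d) \<Rightarrow> bool" where
  "characteristic u T t0 x0 X \<longleftrightarrow>
     X t0 = x0 \<and> (\<forall>t\<in>{0..T}. (X has_vector_derivative u t (X t)) (at t within {0..T}))"

definition divergence :: "(real^'d \<Rightarrow> real^'d) \<Rightarrow> real^'d \<Rightarrow> real" where
  "divergence v x = (\<Sum>i\<in>UNIV. partial_deriv i (\<lambda>y. v y $ i) x)"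

text \<open>
  Instead of a fixed smoothness class, only what smoothness of the velocity is needed for is
  required: the divergence makes sense, and the characteristic problem is well posed on
  \<open>[0,T]\<close> from every initial time and point.
\<close>

definition admissible_velocity :: "real \<Rightarrow> (real \<Rightarrow> real^'d \<Rightarrow> real^'d) \<Rightarrow> bool" where
  "admissible_velocity T u \<longleftrightarrow>
     (\<forall>t\<in>{0..T}. u t differentiable_on UNIV \<and> (\<forall>x. divergence (u t) x = 0)) \<and>
     (\<forall>t0\<in>{0..T}. \<forall>x0.
        (\<exists>X. characteristic u T t0 x0 X) \<and>
        (\<forall>X Y. characteristic u T t0 x0 X \<longrightarrow> characteristic u T t0 x0 Y \<longrightarrow>
           (\<forall>t\<in>{0..T}. X t = Y t)))"

definition flow ::
  "(real \<Rightarrow> real^'d \<Rightarrow> real^'d) \<Rightarrow> real \<Rightarrow> real \<Rightarrow> real \<Rightarrow> real^'d \<Rightarrow> real^'d" where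
  "flow u T t0 t x0 = (SOME X. characteristic u T t0 x0 X) t"

definition exact_transport ::
  "(real^'d \<Rightarrow> real^'d) \<Rightarrow> (real^'d \<Rightarrow> real) \<Rightarrow> real^'d \<Rightarrow> real" where
  "exact_transport F g = g \<circ> inv F"

section \<open>Particles\<close>

definition grid :: "real \<Rightarrow> int^'d \<Rightarrow> real^'d" where
  "grid h k = h *\<^sub>R (\<chi> i. real_of_int (k $ i))"

definition particle ::
  "(real^'d \<Rightarrow> real) \<Rightarrow> real \<Rightarrow> int^'d \<Rightarrow> real^'d \<Rightarrow> real" where
  "particle \<phi> h k x = \<phi> ((1 / h) *\<^sub>R (x - grid h k)) / h ^ CARD('d)"

definition particle_supp :: "(real^'d \<Rightarrow> real) \<Rightarrow> real \<Rightarrow> int^'d \<Rightarrow> (real^'d) set" where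
  "particle_supp \<phi> h k = closure {x. particle \<phi> h k x \<noteq> 0}"

text \<open>
  Sums over all of \<open>\<int>\<^sup>d\<close> are pointwise; for the compactly supported families below only
  finitely many terms are nonzero at each point.
\<close>

definition particle_sum ::
  "(int^'d \<Rightarrow> real) \<Rightarrow> (int^'d \<Rightarrow> real^'d \<Rightarrow> real) \<Rightarrow> real^'d \<Rightarrow> real" where
  "particle_sum c \<psi> x = (\<Sum>\<^sub>\<infinity>k\<in>UNIV. c k * \<psi> k x)"

section \<open>Approximate transport\<close>

definition nth_vector_deriv ::
  "nat \<Rightarrow> (real \<Rightarrow> 'a::real_normed_vector) \<Rightarrow> real \<Rightarrow> 'a" where
  "nth_vector_deriv j = (\<lambda>g t. vector_derivative g (at t)) ^^ j"

definition ray_displacement ::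
  "(real^'d \<Rightarrow> real^'d) \<Rightarrow> real \<Rightarrow> int^'d \<Rightarrow> real^'d \<Rightarrow> real \<Rightarrow> real^'d" where
  "ray_displacement F h k x s =
     (let y = F (grid h k) + s *\<^sub>R (x - F (grid h k)) in inv F y - y)"

definition backward_taylor ::
  "nat \<Rightarrow> (real^'d \<Rightarrow> real^'d) \<Rightarrow> real \<Rightarrow> int^'d \<Rightarrow> real^'d \<Rightarrow> real^'d" where
  "backward_taylor r F h k x =
     x - F (grid h k) + grid h k +
     (\<Sum>j=1..r. (1 / fact j) *\<^sub>R nth_vector_deriv j (ray_displacement F h k x) 0)"

definition forward_affine ::
  "(real^'d \<Rightarrow> real^'d) \<Rightarrow> real \<Rightarrow> int^'d \<Rightarrow> real^'d \<Rightarrow> real^'d" where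
  "forward_affine F h k x = F (grid h k) + jacobian F (at (grid h k)) *v (x - grid h k)"

definition local_radius ::
  "(real^'d \<Rightarrow> real) \<Rightarrow> real \<Rightarrow> (real^'d \<Rightarrow> real^'d) \<Rightarrow> real \<Rightarrow> int^'d \<Rightarrow> real" where
  "local_radius \<phi> \<rho>0 F h k =
     \<rho>0 + 1 / h * linf_norm (F ` particle_supp \<phi> h k) (\<lambda>x. backward_taylor 1 F h k x - inv F x)"

definition apriori_supp ::
  "(real^'d \<Rightarrow> real) \<Rightarrow> real \<Rightarrow> (real^'d \<Rightarrow> real^'d) \<Rightarrow> real \<Rightarrow> int^'d \<Rightarrow> (real^'d) set" where
  "apriori_supp \<phi> \<rho>0 F h k =
     forward_affine F h k ` linf_cball (grid h k) (h * local_radius \<phi> \<rho>0 F h k)"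

definition transported_particle ::
  "nat \<Rightarrow> (real^'d \<Rightarrow> real) \<Rightarrow> real \<Rightarrow> (real^'d \<Rightarrow> real^'d) \<Rightarrow> real \<Rightarrow> int^'d \<Rightarrow> real^'d \<Rightarrow> real"
where
  "transported_particle r \<phi> \<rho>0 F h k x =
     indicator (apriori_supp \<phi> \<rho>0 F h k) x * particle \<phi> h k (backward_taylor r F h k x)"

section \<open>Shape functions and approximation operators\<close>

primrec bspline :: "nat \<Rightarrow> real \<Rightarrow> real" where
  "bspline 0 = indicator {-1/2..1/2}"
| "bspline (Suc p) = (\<lambda>x. LINT y|lborel. bspline p y * indicator {-1/2..1/2} (x - y))"

definition m4_prime :: "real \<Rightarrow> real" where
  "m4_prime s =
     (if \<bar>s\<bar> \<le> 1 then 1 - 5/2 * \<bar>s\<bar>^2 + 3/2 * \<bar>s\<bar>^3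
      else if \<bar>s\<bar> \<le> 2 then 1/2 * (2 - \<bar>s\<bar>)^2 * (1 - \<bar>s\<bar>)
      else 0)"

definition tensor_shape :: "(real \<Rightarrow> real) \<Rightarrow> real^'d \<Rightarrow> real" where
  "tensor_shape b x = (\<Prod>i\<in>UNIV. b (x $ i))"

definition quasi_interp_weight ::
  "nat \<Rightarrow> (int \<Rightarrow> real) \<Rightarrow> real \<Rightarrow> (real^'d \<Rightarrow> real) \<Rightarrow> int^'d \<Rightarrow> real" where
  "quasi_interp_weight m a h g k =
     h ^ CARD('d) *
     (\<Sum>l | \<forall>i. \<bar>l $ i\<bar> \<le> int m. (\<Prod>i\<in>UNIV. a (l $ i)) * g (grid h (k + l)))"

definition nodal_weight :: "real \<Rightarrow> (real^'d \<Rightarrow> real) \<Rightarrow> int^'d \<Rightarrow> real" where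
  "nodal_weight h g k = h ^ CARD('d) * g (grid h k)"

definition approx_op ::
  "(real^'d \<Rightarrow> real) \<Rightarrow> (real \<Rightarrow> (real^'d \<Rightarrow> real) \<Rightarrow> int^'d \<Rightarrow> real) \<Rightarrow>
   real \<Rightarrow> (real^'d \<Rightarrow> real) \<Rightarrow> real^'d \<Rightarrow> real" where
  "approx_op \<phi> w h g = particle_sum (w h g) (particle \<phi> h)"

definition coord_poly :: "nat \<Rightarrow> (real^'d \<Rightarrow> real) \<Rightarrow> bool" where
  "coord_poly p g \<longleftrightarrow>
     (\<exists>c. \<forall>x. g x = (\<Sum>\<alpha> | \<forall>i. \<alpha> i \<le> p. c \<alpha> * (\<Prod>i\<in>UNIV. (x $ i) ^ \<alpha> i)))"

text \<open>
  In the B-spline case the coefficients are any symmetric, finitely supported family for which the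
  operator reproduces the polynomials of coordinate degree at most \<open>p\<close>. The Chui--Diamond
  coefficients are one such family for each \<open>p\<close>.
\<close>

inductive particle_scheme ::
  "(real^'d \<Rightarrow> real) \<Rightarrow> real \<Rightarrow> (real \<Rightarrow> (real^'d \<Rightarrow> real) \<Rightarrow> int^'d \<Rightarrow> real) \<Rightarrow> bool" where
  bspline_scheme:
    "particle_scheme (tensor_shape (bspline p)) ((real p + 1) / 2) (quasi_interp_weight m a)"
    if "1 \<le> p" and "\<forall>l. a (- l) = a l"
      and "\<forall>h g. 0 < h \<longrightarrow> coord_poly p (g :: real^'d \<Rightarrow> real) \<longrightarrow>
             approx_op (tensor_shape (bspline p)) (quasi_interp_weight m a) h g = g"
| m4_scheme:
    "particle_scheme (tensor_shape m4_prime) 2 nodal_weight"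

section \<open>Quantities in the error estimate\<close>

definition global_radius :: "real \<Rightarrow> (real^'d \<Rightarrow> real^'d) \<Rightarrow> real \<Rightarrow> real" where
  "global_radius \<rho>0 F h =
     \<rho>0 * (1 + h * \<rho>0 / 2 * (seminorm 1 UNIV F)^2 * seminorm 2 UNIV (inv F))"

definition c_flow :: "nat \<Rightarrow> real \<Rightarrow> (real^'d \<Rightarrow> real^'d) \<Rightarrow> real \<Rightarrow> real" where
  "c_flow s \<rho>0 F h =
     (global_radius \<rho>0 F h * seminorm 1 UNIV F) ^ (s + 1) * seminorm (s + 1) UNIV (inv F)"

definition transport_error ::
  "nat \<Rightarrow> (real^'d \<Rightarrow> real) \<Rightarrow> real \<Rightarrow> (real \<Rightarrow> (real^'d \<Rightarrow> real) \<Rightarrow> int^'d \<Rightarrow> real) \<Rightarrow>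
   (real^'d \<Rightarrow> real^'d) \<Rightarrow> real \<Rightarrow> (real^'d \<Rightarrow> real) \<Rightarrow> real^'d \<Rightarrow> real" where
  "transport_error r \<phi> \<rho>0 w F h f0 x =
     particle_sum (w h f0) (transported_particle r \<phi> \<rho>0 F h) x
     - exact_transport F (approx_op \<phi> w h f0) x"

end

theory Submission
  imports Defs
begin

text \<open>
  Write \<open>B = inv F\<close> and \<open>x\<^sub>k = grid h k\<close>. Both operators are linear in the weights, so at a point
  \<open>x\<close> the error is the sum over \<open>k\<close> of the weight \<open>w\<^sub>k\<close> times the difference between the transported
  particle and the particle evaluated at \<open>B x\<close>. Three facts control this sum.

  \<^item> Truncation by the a priori support costs nothing. If the exactly transported particle is nonzero
    at \<open>x\<close>, then \<open>B x\<close> is within \<open>h \<rho>0\<close> of \<open>x\<^sub>k\<close>, and replacing \<open>B\<close> by its affine approximation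
    moves the point by at most the correction built into the radius of the a priori support
    (\<open>exact_particle_in_apriori_supp\<close>).

  \<^item> Each active term is small. On the a priori support, \<open>x\<close> lies within
    \<open>h \<rho> |F|\<^sub>1\<close> of \<open>F x\<^sub>k\<close>, \<open>\<rho>\<close> being the global radius, so Taylor's theorem bounds the distance of
    the polynomial backward map to \<open>B x\<close> by \<open>h\<^bsup>r+1\<^esup>\<close> times the flow constant of order \<open>r\<close>. The shape function is
    Lipschitz and the scaled particle has Lipschitz constant of order \<open>h\<^bsup>-d-1\<^esup>\<close>
    (\<open>single_particle_error_le\<close>). The weights are of size \<open>h\<^bsup>d\<^esup>\<close>, which cancels the remaining negative
    power of \<open>h\<close>.

  \<^item> Few terms are active. An active particle has \<open>x\<^sub>k\<close> within \<open>h (\<rho>0 + h c)\<close> of \<open>B x\<close>, where \<open>c\<close>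
    is the flow constant of order one (\<open>apriori_supp_near_preimage\<close>). A cube of that size contains
    at most a constant times \<open>(1 + h c)\<^bsup>d\<^esup>\<close> grid points (\<open>card_grid_points_le\<close>).

  The counting takes place in a cube around the common point \<open>B x\<close>, where the centres are still the
  points of the regular grid. That \<open>B\<close> is a two-sided inverse of the flow follows from existence and
  uniqueness of characteristics (\<open>bij_flow\<close>).
\<close>

section \<open>The maximum norm\<close>

lemma infnorm_cart_leI:
  fixes x :: "real^'d"
  assumes "\<And>i. \<bar>x $ i\<bar> \<le> c"
  shows "infnorm x \<le> c"
  unfolding infnorm_cart by (rule cSup_least) (use assms in auto)

lemma infnorm_real_eq_abs: "infnorm (x::real) = \<bar>x\<bar>"
  by (simp add: infnorm_def)

lemma bdd_above_infnorm_image: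
  assumes "bounded (v ` \<omega>)"
  shows "bdd_above ((\<lambda>x. infnorm (v x)) ` \<omega>)"
proof -
  obtain b where "\<forall>y\<in>v ` \<omega>. norm y \<le> b"
    using assms by (auto simp: bounded_iff)
  then show ?thesis
    by (intro bdd_aboveI[of _ b]) (use infnorm_le_norm order_trans in blast)
qed

lemma infnorm_le_linf_norm:
  assumes "bounded (v ` \<omega>)" "x \<in> \<omega>"
  shows "infnorm (v x) \<le> linf_norm \<omega> v"
  unfolding linf_norm_def by (rule cSUP_upper[OF assms(2) bdd_above_infnorm_image[OF assms(1)]])

lemma linf_norm_nonneg:
  assumes "bounded (v ` \<omega>)" "\<omega> \<noteq> {}"
  shows "0 \<le> linf_norm \<omega> v"
  using assms infnorm_le_linf_norm infnorm_pos_le order_trans by (metis ex_in_conv)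

lemma closed_linf_cball: "closed (linf_cball x \<rho>)"
  unfolding linf_cball_def
  by (intro closed_Collect_le continuous_intros continuous_on_infnorm)

section \<open>Directional derivatives and Taylor expansion\<close>

text \<open>
  For smooth \<open>g\<close>, the \<open>m\<close>-th derivative at \<open>x\<close> applied to \<open>m\<close> copies of \<open>v\<close>, expanded over all sequences of
  partial derivatives. In this form the sum of sup norms in the semi-norm bounds it term by term.
\<close>

definition dir_deriv :: "nat \<Rightarrow> real^'d \<Rightarrow> (real^'d \<Rightarrow> real) \<Rightarrow> real^'d \<Rightarrow> real" where
  "dir_deriv m v g x = (\<Sum>ls | length ls = m. prod_list (map (($) v) ls) * iter_partial ls g x)"

lemma dir_deriv_0: "dir_deriv 0 v g x = g x"
  by (simp add: dir_deriv_def iter_partial_def)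

lemma dir_deriv_Suc:
  "dir_deriv (Suc m) v g x =
     (\<Sum>ls | length ls = m. prod_list (map (($) v) ls) *
        (\<Sum>j\<in>UNIV. v $ j * partial_deriv j (iter_partial ls g) x))"
proof -
  have img: "{ls :: 'a list. length ls = Suc m} = (\<lambda>(ls, j). j # ls) ` ({ls. length ls = m} \<times> UNIV)"
    by (auto simp: length_Suc_conv image_iff)
  have inj: "inj_on (\<lambda>(ls :: 'a list, j). j # ls) ({ls. length ls = m} \<times> UNIV)"
    by (auto simp: inj_on_def)
  show ?thesis
    unfolding dir_deriv_def img
    by (subst sum.reindex[OF inj])
       (simp add: sum.cartesian_product sum_distrib_left iter_partial_def split_def mult_ac)
qed

lemma derivative_along_line:
  assumes "(g has_derivative g') (at (a + s *\<^sub>R v))"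
  shows "((\<lambda>t. g (a + t *\<^sub>R v)) has_vector_derivative g' v) (at s)"
proof -
  have "((\<lambda>t. a + t *\<^sub>R v) has_vector_derivative v) (at s)"
    by (auto intro!: derivative_eq_intros simp: has_vector_derivative_def)
  from vector_derivative_diff_chain_within[OF this, of g g'] assms
  show ?thesis by (simp add: o_def has_derivative_at_withinI)
qed

lemma partial_derivs_represent_derivative:
  fixes g :: "real^'d \<Rightarrow> real"
  assumes "(g has_derivative g') (at x)"
  shows "(\<Sum>j\<in>UNIV. v $ j * partial_deriv j g x) = g' v"
proof -
  interpret bounded_linear g'
    using assms by (rule has_derivative_bounded_linear)
  have "partial_deriv j g x = g' (axis j 1)" for j
    unfolding partial_deriv_def
    using derivative_along_line[of g g' x 0 "axis j 1"] assms
    by (intro DERIV_imp_deriv) (simp add: has_real_derivative_iff_has_vector_derivative)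
  moreover have "g' v = g' (\<Sum>j\<in>UNIV. v $ j *s axis j 1)"
    by (simp add: basis_expansion)
  ultimately show ?thesis
    by (simp add: sum scaleR scalar_mult_eq_scaleR)
qed

lemma dir_deriv_1:
  assumes "(g has_derivative g') (at x)"
  shows "dir_deriv 1 v g x = g' v"
  using partial_derivs_represent_derivative[OF assms, of v]
  by (simp add: dir_deriv_Suc iter_partial_def)

text \<open>
  The class is defined by differentiating first, whereas \<^const>\<open>iter_partial\<close> applies the head of the list last;
  hence the induction from the end of the list.
\<close>

lemma cont_diff_iter_partial:
  "cont_diff (length ls + m) g \<Longrightarrow> cont_diff m (iter_partial ls g)"
  by (induction ls arbitrary: g rule: rev_induct) (auto simp: iter_partial_def)

lemma cont_diff_antimono: "cont_diff n g \<Longrightarrow> m \<le> n \<Longrightarrow> cont_diff m g"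
proof (induction n arbitrary: m g)
  case (Suc n)
  then show ?case
    by (cases m) (simp_all add: differentiable_imp_continuous_on)
qed simp

lemma has_derivative_dir_deriv:
  assumes "cont_diff n g" "m < n"
  shows "((\<lambda>s. dir_deriv m v g (a + s *\<^sub>R v)) has_real_derivative
            dir_deriv (Suc m) v g (a + s *\<^sub>R v)) (at s)"
proof -
  have line: "((\<lambda>s. iter_partial ls g (a + s *\<^sub>R v)) has_real_derivative
          (\<Sum>j\<in>UNIV. v $ j * partial_deriv j (iter_partial ls g) (a + s *\<^sub>R v))) (at s)"
    if "length ls = m" for ls
  proof -
    have "cont_diff (Suc 0) (iter_partial ls g)"
      by (intro cont_diff_iter_partial cont_diff_antimono[OF assms(1)]) (use assms(2) that in simp)
    then obtain g' where g': "(iter_partial ls g has_derivative g') (at (a + s *\<^sub>R v))"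
      by (auto simp: differentiable_on_def differentiable_def)
    show ?thesis
      unfolding partial_derivs_represent_derivative[OF g']
      using derivative_along_line[OF g']
      by (simp add: has_real_derivative_iff_has_vector_derivative)
  qed
  show ?thesis
    unfolding dir_deriv_Suc unfolding dir_deriv_def
    by (intro DERIV_sum DERIV_cmult line) simp
qed

lemma sum_linf_norm_le_seminorm:
  "(\<Sum>ls | length ls = m. linf_norm \<omega> (iter_partial ls (\<lambda>x. f x $ i))) \<le> seminorm m \<omega> f"
  unfolding seminorm_def by (rule Max_ge) auto

lemma seminorm_nonneg:
  assumes "finite_seminorm m UNIV f"
  shows "0 \<le> seminorm m UNIV f"
  by (rule order_trans[OF _ sum_linf_norm_le_seminorm[where i = undefined]])
     (use assms in \<open>auto intro!: sum_nonneg linf_norm_nonneg simp: finite_seminorm_def\<close>)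

lemma abs_prod_list_le_infnorm_power:
  fixes v :: "real^'d"
  shows "\<bar>prod_list (map (($) v) ls)\<bar> \<le> infnorm v ^ length ls"
  by (induction ls) (auto simp: abs_mult intro!: mult_mono component_le_infnorm_cart infnorm_pos_le)

lemma abs_dir_deriv_le:
  assumes "finite_seminorm m UNIV f"
  shows "\<bar>dir_deriv m v (\<lambda>x. f x $ i) x\<bar> \<le> infnorm v ^ m * seminorm m UNIV f"
proof -
  have "\<bar>dir_deriv m v (\<lambda>x. f x $ i) x\<bar>
      \<le> (\<Sum>ls | length ls = m. infnorm v ^ m * linf_norm UNIV (iter_partial ls (\<lambda>x. f x $ i)))"
    unfolding dir_deriv_def
  proof (intro order_trans[OF sum_abs] sum_mono)
    fix ls :: "'a list" assume "ls \<in> {ls. length ls = m}"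
    then have len: "length ls = m" by simp
    have "\<bar>iter_partial ls (\<lambda>x. f x $ i) x\<bar> \<le> linf_norm UNIV (iter_partial ls (\<lambda>x. f x $ i))"
      using infnorm_le_linf_norm[of "iter_partial ls (\<lambda>x. f x $ i)" UNIV x] assms len
      by (auto simp: finite_seminorm_def infnorm_real_eq_abs)
    then show "\<bar>prod_list (map (($) v) ls) * iter_partial ls (\<lambda>x. f x $ i) x\<bar>
        \<le> infnorm v ^ m * linf_norm UNIV (iter_partial ls (\<lambda>x. f x $ i))"
      using abs_prod_list_le_infnorm_power[of v ls] len
      by (auto simp: abs_mult intro!: mult_mono infnorm_pos_le zero_le_power)
  qed
  also have "\<dots> \<le> infnorm v ^ m * seminorm m UNIV f"
    unfolding sum_distrib_left[symmetric]
    by (intro mult_left_mono sum_linf_norm_le_seminorm zero_le_power infnorm_pos_le)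
  finally show ?thesis .
qed

text \<open>
  Taylor's formula with Lagrange remainder on the segment from \<open>a\<close> to \<open>a + v\<close>, one component at a
  time, since the intermediate point depends on the component. The case \<open>n = 1\<close> is the mean value
  inequality.
\<close>

lemma taylor_remainder_le:
  assumes "cont_diff_map n f" "finite_seminorm n UNIV f"
  shows "\<bar>f (a + v) $ i - (\<Sum>m<n. dir_deriv m v (\<lambda>x. f x $ i) a / fact m)\<bar>
          \<le> infnorm v ^ n * seminorm n UNIV f / fact n"
proof -
  define g where "g = (\<lambda>x. f x $ i)"
  have cd: "cont_diff n g"
    using assms(1) by (auto simp: cont_diff_map_def g_def)
  have "\<exists>t. \<bar>t\<bar> \<le> \<bar>1\<bar> \<and> g (a + 1 *\<^sub>R v) =
      (\<Sum>m<n. dir_deriv m v g (a + 0 *\<^sub>R v) / fact m * 1 ^ m) + dir_deriv n v g (a + t *\<^sub>R v) / fact n * 1 ^ n"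
    by (rule Maclaurin_bi_le[of "\<lambda>m s. dir_deriv m v g (a + s *\<^sub>R v)"])
       (use has_derivative_dir_deriv[OF cd] in \<open>auto simp: dir_deriv_0\<close>)
  then obtain t where "g (a + v) - (\<Sum>m<n. dir_deriv m v g a / fact m) = dir_deriv n v g (a + t *\<^sub>R v) / fact n"
    by auto
  then show ?thesis
    using abs_dir_deriv_le[OF assms(2), of v i "a + t *\<^sub>R v"]
    by (simp add: g_def divide_right_mono)
qed

lemma infnorm_diff_le_seminorm:
  assumes "cont_diff_map 1 f" "finite_seminorm 1 UNIV f"
  shows "infnorm (f y - f x) \<le> seminorm 1 UNIV f * infnorm (y - x)"
  by (rule infnorm_cart_leI)
     (use taylor_remainder_le[OF assms, of x "y - x"] in \<open>simp add: dir_deriv_0 mult.commute\<close>)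

lemma has_vector_derivative_vec_lambda:
  fixes f :: "'d::finite \<Rightarrow> real \<Rightarrow> real"
  assumes "\<And>i. (f i has_vector_derivative f' i) (at s)"
  shows "((\<lambda>t. \<chi> i. f i t) has_vector_derivative (\<chi> i. f' i)) (at s)"
  using assms unfolding has_vector_derivative_def
  by (subst has_derivative_componentwise_within) (auto simp: Basis_vec_def inner_axis)

section \<open>Local approximations of the flow\<close>

text \<open>
  Along the ray, the identity part of the displacement contributes to the derivatives of order zero
  and one only; this is the correction subtracted below.
\<close>

lemma nth_vector_deriv_ray_displacement:
  fixes F :: "real^'d \<Rightarrow> real^'d" and h :: real and k :: "int^'d"
  assumes "cont_diff_map r (inv F)" "j \<le> r"
  defines "a \<equiv> F (grid h k)"
  shows "nth_vector_deriv j (ray_displacement F h k x) s =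
    (\<chi> i. dir_deriv j (x - a) (\<lambda>y. inv F y $ i) (a + s *\<^sub>R (x - a))
      - (if j = 0 then (a + s *\<^sub>R (x - a)) $ i else if j = 1 then (x - a) $ i else 0))"
  using assms(2)
proof (induction j arbitrary: s)
  case 0
  show ?case
    by (simp add: nth_vector_deriv_def ray_displacement_def Let_def a_def dir_deriv_0 vec_eq_iff)
next
  case (Suc j)
  define v where "v = x - a"
  have "((\<lambda>s. \<chi> i. dir_deriv j v (\<lambda>y. inv F y $ i) (a + s *\<^sub>R v)
         - (if j = 0 then (a + s *\<^sub>R v) $ i else if j = 1 then v $ i else 0))
      has_vector_derivative (\<chi> i. dir_deriv (Suc j) v (\<lambda>y. inv F y $ i) (a + s *\<^sub>R v)
         - (if j = 0 then v $ i else 0))) (at s)"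
  proof (rule has_vector_derivative_vec_lambda)
    fix i
    have "((\<lambda>s. dir_deriv j v (\<lambda>y. inv F y $ i) (a + s *\<^sub>R v)) has_real_derivative
        dir_deriv (Suc j) v (\<lambda>y. inv F y $ i) (a + s *\<^sub>R v)) (at s)"
      by (rule has_derivative_dir_deriv[of r])
         (use assms(1) Suc.prems in \<open>auto simp: cont_diff_map_def\<close>)
    then show "((\<lambda>s. dir_deriv j v (\<lambda>y. inv F y $ i) (a + s *\<^sub>R v)
         - (if j = 0 then (a + s *\<^sub>R v) $ i else if j = 1 then v $ i else 0))
      has_vector_derivative dir_deriv (Suc j) v (\<lambda>y. inv F y $ i) (a + s *\<^sub>R v)
         - (if j = 0 then v $ i else 0)) (at s)"
      unfolding has_real_derivative_iff_has_vector_derivative[symmetric]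
      by (auto intro!: derivative_eq_intros)
  qed
  then have "vector_derivative (nth_vector_deriv j (ray_displacement F h k x)) (at s)
      = (\<chi> i. dir_deriv (Suc j) v (\<lambda>y. inv F y $ i) (a + s *\<^sub>R v) - (if j = 0 then v $ i else 0))"
    unfolding v_def ext[OF Suc.IH[OF Suc_leD[OF Suc.prems]]] by (rule vector_derivative_at)
  then show ?case
    by (simp add: nth_vector_deriv_def v_def cong: if_cong)
qed

text \<open>
  The derivatives of the displacement are those of the inverse map except for the identity part, whose
  derivative of order one cancels against the term \<open>x - F x\<^sub>k\<close>. Since that derivative has to occur in the
  sum, the order must be at least one.
\<close>

lemma backward_taylor_component:
  fixes F :: "real^'d \<Rightarrow> real^'d" and h :: real and k :: "int^'d"
  assumes "cont_diff_map r (inv F)" "1 \<le> r" "inj F"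
  defines "a \<equiv> F (grid h k)"
  shows "backward_taylor r F h k x $ i = (\<Sum>m<Suc r. dir_deriv m (x - a) (\<lambda>y. inv F y $ i) a / fact m)"
proof -
  have "(\<Sum>j=1..r. (1 / fact j) *\<^sub>R nth_vector_deriv j (ray_displacement F h k x) 0) $ i
      = (\<Sum>j=1..r. dir_deriv j (x - a) (\<lambda>y. inv F y $ i) a / fact j - (if j = 1 then (x - a) $ i else 0))"
    unfolding sum_component
    by (rule sum.cong) (auto simp: nth_vector_deriv_ray_displacement[OF assms(1)] a_def)
  also have "\<dots> = (\<Sum>j=1..r. dir_deriv j (x - a) (\<lambda>y. inv F y $ i) a / fact j) - (x - a) $ i"
    using assms(2) by (simp add: sum_subtractf)
  moreover have "{..<Suc r} = insert 0 {1..r}"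
    by auto
  ultimately show ?thesis
    using assms(3) by (simp add: backward_taylor_def a_def dir_deriv_0)
qed

section \<open>Shape functions\<close>

text \<open>
  Convolution with the indicator of a unit interval averages over a window of length one: it keeps the
  bound one, and moving the window by \<open>\<delta>\<close> exchanges two pieces of length at most \<open>\<delta>\<close>, which gives the
  Lipschitz constant two.
\<close>

lemma bspline_step:
  fixes b :: "real \<Rightarrow> real"
  assumes "b \<in> borel_measurable borel" "\<And>y. \<bar>b y\<bar> \<le> 1"
  defines "I \<equiv> \<lambda>x. LINT y|lborel. b y * indicator {-1/2..1/2} (x - y)"
  shows "\<bar>I x - I x'\<bar> \<le> 2 * \<bar>x - x'\<bar>" and "\<bar>I x\<bar> \<le> 1"
proof -
  have I: "I x = (LINT y|lborel. b y * indicator {x - 1/2..x + 1/2} y)" for x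
    unfolding I_def by (intro Bochner_Integration.integral_cong) (auto simp: indicator_def)
  have meas [measurable]: "b \<in> borel_measurable borel" by fact
  have indicator_int: "integrable lborel (indicator {c..d} :: real \<Rightarrow> real)" for c d :: real
    by (rule integrable_real_indicator) (auto simp: emeasure_lborel_Icc_eq)
  have int: "integrable lborel (\<lambda>y. b y * indicator {x - 1/2..x + 1/2} y)" for x
    by (rule Bochner_Integration.integrable_bound[OF indicator_int[of "x - 1/2" "x + 1/2"]])
       (use assms(2) in \<open>auto simp: indicator_def\<close>)
  have "\<bar>I x\<bar> \<le> (LINT y|lborel. indicator {x - 1/2..x + 1/2} y)"
    unfolding I real_norm_def[symmetric]
    by (rule Bochner_Integration.integral_norm_bound_integral[OF int indicator_int]) (use assms(2) in \<open>auto simp: indicator_def\<close>)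
  then show "\<bar>I x\<bar> \<le> 1" by simp
  have ordered: "\<bar>I x - I x'\<bar> \<le> 2 * \<bar>x - x'\<bar>" if "x \<le> x'" for x x'
  proof -
    have "\<bar>I x - I x'\<bar> = \<bar>LINT y|lborel. b y * indicator {x - 1/2..x + 1/2} y - b y * indicator {x' - 1/2..x' + 1/2} y\<bar>"
      unfolding I Bochner_Integration.integral_diff[OF int int] by (rule refl)
    also have "\<dots> \<le> (LINT y|lborel. indicator {x - 1/2..x' - 1/2} y + indicator {x + 1/2..x' + 1/2} y)"
      unfolding real_norm_def[symmetric]
    proof (rule Bochner_Integration.integral_norm_bound_integral)
      fix y
      have "\<bar>indicator {x - 1/2..x + 1/2} y - indicator {x' - 1/2..x' + 1/2} y\<bar>
         \<le> indicator {x - 1/2..x' - 1/2} y + (indicator {x + 1/2..x' + 1/2} y :: real)"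
        using that by (auto simp: indicator_def)
      from mult_mono[OF assms(2)[of y] this zero_le_one abs_ge_zero]
      show "norm (b y * indicator {x - 1/2..x + 1/2} y - b y * indicator {x' - 1/2..x' + 1/2} y)
         \<le> indicator {x - 1/2..x' - 1/2} y + (indicator {x + 1/2..x' + 1/2} y :: real)"
        unfolding right_diff_distrib[symmetric] real_norm_def abs_mult mult_1 .
    qed (rule Bochner_Integration.integrable_diff[OF int int]
          Bochner_Integration.integrable_add[OF indicator_int indicator_int])+
    also have "\<dots> = 2 * \<bar>x - x'\<bar>"
      unfolding Bochner_Integration.integral_add[OF indicator_int indicator_int] using that by simp
    finally show ?thesis .
  qed
  show "\<bar>I x - I x'\<bar> \<le> 2 * \<bar>x - x'\<bar>"
    using ordered[of x x'] ordered[of x' x] by (cases "x \<le> x'") (auto simp: abs_minus_commute)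
qed

text \<open>
  Measurability is carried along because the next convolution needs it. After one convolution it
  follows from the Lipschitz bound, by continuity.
\<close>

lemma bspline_measurable_bounded:
  "bspline p \<in> borel_measurable borel \<and> (\<forall>x. \<bar>bspline p x\<bar> \<le> 1)"
proof (induction p)
  case 0
  show ?case by (auto simp: indicator_def)
next
  case (Suc p)
  note step = bspline_step[OF conjunct1[OF Suc] spec[OF conjunct2[OF Suc]], folded bspline.simps(2)[THEN fun_cong]]
  have "continuous_on UNIV (bspline (Suc p))"
    by (intro lipschitz_on_continuous_on[of 2] lipschitz_onI, unfold dist_real_def) (rule step(1), simp)
  then have "bspline (Suc p) \<in> borel_measurable borel"
    by (rule borel_measurable_continuous_onI)
  then show ?case
    using step(2) by blast
qed

lemma bspline_lipschitz:
  assumes "1 \<le> p"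
  shows "\<bar>bspline p x - bspline p y\<bar> \<le> 2 * \<bar>x - y\<bar>"
proof -
  obtain q where q: "p = Suc q" using assms by (cases p) auto
  have "bspline q \<in> borel_measurable borel" "\<And>y. \<bar>bspline q y\<bar> \<le> 1"
    using bspline_measurable_bounded by blast+
  from bspline_step(1)[OF this] show ?thesis
    unfolding q bspline.simps .
qed

lemma bspline_support: "bspline p x \<noteq> 0 \<Longrightarrow> \<bar>x\<bar> \<le> (real p + 1) / 2"
proof (induction p arbitrary: x)
  case 0
  then show ?case by (auto simp: indicator_def split: if_splits)
next
  case (Suc p)
  show ?case
  proof (rule ccontr)
    assume "\<not> \<bar>x\<bar> \<le> (real (Suc p) + 1) / 2"
    then have far: "(real p + 1) / 2 + 1 / 2 < \<bar>x\<bar>" by (simp add: field_simps)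
    have "bspline p y * indicator {-1/2..1/2} (x - y) = 0" for y :: real
    proof (cases "bspline p y = 0")
      case False
      then have "x - y \<notin> {-1/2..1/2}"
        using Suc.IH[OF False] far unfolding atLeastAtMost_iff by linarith
      then show ?thesis by simp
    qed simp
    then show False
      using Suc.prems unfolding bspline.simps by (simp only: Bochner_Integration.integral_zero)
  qed
qed

text \<open>
  The inner polynomial vanishes at 1 and the outer one at 1 and 2, so the
  piecewise function is a sum of two polynomials in clamped copies of \<open>\<bar>s\<bar>\<close>. Clamping is
  1-Lipschitz, which reduces the Lipschitz bound to that of polynomials on a unit interval.
\<close>

lemma m4_prime_clamped:
  "m4_prime s = (1 - 5/2 * (min \<bar>s\<bar> 1)^2 + 3/2 * (min \<bar>s\<bar> 1)^3)
     - 1/2 * (1 - (max 1 (min \<bar>s\<bar> 2) - 1))^2 * (max 1 (min \<bar>s\<bar> 2) - 1)"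
proof -
  consider "\<bar>s\<bar> \<le> 1" | "1 < \<bar>s\<bar>" "\<bar>s\<bar> \<le> 2" | "2 < \<bar>s\<bar>" by linarith
  then show ?thesis
  proof cases
    case 2
    then have "min \<bar>s\<bar> 1 = 1" "max 1 (min \<bar>s\<bar> 2) = \<bar>s\<bar>" by auto
    with 2 show ?thesis by (simp add: m4_prime_def field_simps)
  qed (auto simp: m4_prime_def)
qed

lemma m4_prime_lipschitz: "\<bar>m4_prime x - m4_prime y\<bar> \<le> 10 * \<bar>x - y\<bar>"
proof -
  define u where "u = (\<lambda>s::real. min \<bar>s\<bar> 1)"
  define z where "z = (\<lambda>s::real. max 1 (min \<bar>s\<bar> 2) - 1)"
  have m4: "m4_prime s = (1 - 5/2 * u s^2 + 3/2 * u s^3) - 1/2 * (1 - z s)^2 * z s" for s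
    unfolding u_def z_def by (rule m4_prime_clamped)
  have u: "0 \<le> u s" "u s \<le> 1" and z: "0 \<le> z s" "z s \<le> 1" for s
    by (simp_all add: u_def z_def)
  have min_lip: "\<bar>min s c - min t c\<bar> \<le> \<bar>s - t\<bar>" for s t c :: real by linarith
  have max_lip: "\<bar>max c s - max c t\<bar> \<le> \<bar>s - t\<bar>" for s t c :: real by linarith
  have du: "\<bar>u x - u y\<bar> \<le> \<bar>x - y\<bar>"
    unfolding u_def by (rule order_trans[OF min_lip abs_triangle_ineq3])
  have dz: "\<bar>z x - z y\<bar> \<le> \<bar>x - y\<bar>"
  proof -
    have shift: "(p - 1) - (q - 1) = p - q" for p q :: real by simp
    show ?thesis
      unfolding z_def shift
      by (rule order_trans[OF max_lip order_trans[OF min_lip abs_triangle_ineq3]])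
  qed
  \<comment> \<open>The divided differences of the two polynomials.\<close>
  define A where "A = -5/2 * (u x + u y) + 3/2 * (u x * u x + u x * u y + u y * u y)"
  define B where "B = - 1/2 * (1 - 2 * (z x + z y) + (z x * z x + z x * z y + z y * z y))"
  have sums: "0 \<le> p + q" "p + q \<le> 2" "0 \<le> p * p + p * q + q * q" "p * p + p * q + q * q \<le> 3"
    if "0 \<le> p" "p \<le> 1" "0 \<le> q" "q \<le> 1" for p q :: real
    using that mult_le_one[of p p] mult_le_one[of p q] mult_le_one[of q q] by auto
  have "\<bar>-5/2 * p + 3/2 * q\<bar> \<le> 5" "\<bar>- 1/2 * (1 - 2 * p + q)\<bar> \<le> 5"
    if "0 \<le> p" "p \<le> 2" "0 \<le> q" "q \<le> 3" for p q :: real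
    using that by (simp_all add: abs_le_iff)
  then have A: "\<bar>A\<bar> \<le> 5" and B: "\<bar>B\<bar> \<le> 5"
    unfolding A_def B_def using sums[OF u[of x] u[of y]] sums[OF z[of x] z[of y]] by blast+
  have "\<bar>(u x - u y) * A\<bar> \<le> \<bar>x - y\<bar> * 5"
    unfolding abs_mult by (rule mult_mono[OF du A abs_ge_zero abs_ge_zero])
  moreover have "\<bar>(z x - z y) * B\<bar> \<le> \<bar>x - y\<bar> * 5"
    unfolding abs_mult by (rule mult_mono[OF dz B abs_ge_zero abs_ge_zero])
  moreover have "m4_prime x - m4_prime y = (u x - u y) * A + (z x - z y) * B"
    unfolding m4 A_def B_def by algebra
  ultimately show ?thesis by linarith
qed

lemma m4_prime_bounded: "\<bar>m4_prime s\<bar> \<le> 1"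
proof -
  define t where "t = \<bar>s\<bar>"
  have t0: "0 \<le> t" by (simp add: t_def)
  consider "t \<le> 1" | "1 < t" "t \<le> 2" | "2 < t" by linarith
  then show ?thesis
  proof cases
    case 1
    have sq: "t * t \<le> t" using t0 1 by (simp add: mult_left_le)
    have eq: "m4_prime s = (1 - t) * (1 + t - 3/2 * (t * t))"
             "m4_prime s = 1 - t * t * (5 - 3 * t) / 2"
      using 1 by (simp_all add: m4_prime_def t_def[symmetric] field_simps power2_eq_square power3_eq_cube)
    have "0 \<le> m4_prime s"
      unfolding eq(1) using 1 t0 sq by (intro mult_nonneg_nonneg) auto
    moreover have "0 \<le> t * t * (5 - 3 * t)" using 1 t0 by (intro mult_nonneg_nonneg) auto
    then have "m4_prime s \<le> 1" unfolding eq(2) by simp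
    ultimately show ?thesis by simp
  next
    case 2
    have "m4_prime s = 1/2 * (2 - t)^2 * (1 - t)"
      using 2 by (simp add: m4_prime_def t_def[symmetric])
    then have "\<bar>m4_prime s\<bar> = 1/2 * (2 - t)^2 * (t - 1)"
      using 2 by (simp only: abs_mult) simp
    also have "\<dots> \<le> 1/2 * 1^2 * 1"
      using 2 by (intro mult_mono power_mono) auto
    finally show ?thesis by simp
  next
    case 3
    then show ?thesis by (simp add: m4_prime_def t_def)
  qed
qed

lemma m4_prime_support: "m4_prime s \<noteq> 0 \<Longrightarrow> \<bar>s\<bar> \<le> 2"
  by (rule ccontr) (simp add: m4_prime_def)

lemma tensor_shape_lipschitz:
  fixes x y :: "real^'d"
  assumes "\<And>s. \<bar>b s\<bar> \<le> 1" "\<And>s t. \<bar>b s - b t\<bar> \<le> L * \<bar>s - t\<bar>" "0 \<le> L"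
  shows "\<bar>tensor_shape b x - tensor_shape b y\<bar> \<le> real CARD('d) * L * infnorm (x - y)"
proof -
  have "\<bar>tensor_shape b x - tensor_shape b y\<bar> \<le> (\<Sum>i\<in>UNIV. \<bar>b (x $ i) - b (y $ i)\<bar>)"
    unfolding tensor_shape_def real_norm_def[symmetric]
    by (rule norm_prod_diff) (use assms(1) in auto)
  also have "\<dots> \<le> (\<Sum>i\<in>(UNIV::'d set). L * infnorm (x - y))"
  proof (rule sum_mono)
    fix i
    show "\<bar>b (x $ i) - b (y $ i)\<bar> \<le> L * infnorm (x - y)"
      using assms(2)[of "x $ i" "y $ i"] component_le_infnorm_cart[of "x - y" i]
        mult_left_mono[OF _ assms(3)] by (metis order_trans vector_minus_component)
  qed
  finally show ?thesis by simp
qed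

lemma tensor_shape_support:
  fixes x :: "real^'d"
  assumes "\<And>s. b s \<noteq> 0 \<Longrightarrow> \<bar>s\<bar> \<le> \<rho>" "tensor_shape b x \<noteq> 0"
  shows "infnorm x \<le> \<rho>"
  by (rule infnorm_cart_leI) (use assms in \<open>auto simp: tensor_shape_def\<close>)

lemma particle_scheme_shape:
  fixes \<phi> :: "real^'d \<Rightarrow> real"
  assumes "particle_scheme \<phi> \<rho>0 w"
  obtains L where "0 < \<rho>0" "0 \<le> L" "\<And>x. \<phi> x \<noteq> 0 \<Longrightarrow> infnorm x \<le> \<rho>0"
    "\<And>x y. \<bar>\<phi> x - \<phi> y\<bar> \<le> L * infnorm (x - y)"
  using assms
proof cases
  case (bspline_scheme p a m)
  show ?thesis
  proof (rule that[of "real CARD('d) * 2"])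
    fix x y
    show "\<bar>\<phi> x - \<phi> y\<bar> \<le> real CARD('d) * 2 * infnorm (x - y)"
      unfolding bspline_scheme(1)
      by (rule tensor_shape_lipschitz)
         (use bspline_measurable_bounded bspline_lipschitz[OF bspline_scheme(4)] in \<open>blast | simp\<close>)+
  next
    fix x assume "\<phi> x \<noteq> 0"
    then show "infnorm x \<le> \<rho>0"
      unfolding bspline_scheme using tensor_shape_support[of "bspline p", OF bspline_support] by blast
  qed (use bspline_scheme in auto)
next
  case m4_scheme
  show ?thesis
  proof (rule that[of "real CARD('d) * 10"])
    fix x y
    show "\<bar>\<phi> x - \<phi> y\<bar> \<le> real CARD('d) * 10 * infnorm (x - y)"
      unfolding m4_scheme(1)
      by (rule tensor_shape_lipschitz) (use m4_prime_bounded m4_prime_lipschitz in auto)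
  next
    fix x assume "\<phi> x \<noteq> 0"
    then show "infnorm x \<le> \<rho>0"
      unfolding m4_scheme using tensor_shape_support[of m4_prime, OF m4_prime_support] by blast
  qed (use m4_scheme in auto)
qed

text \<open>
  The weights are \<open>h\<^bsup>d\<^esup>\<close> times a fixed linear combination of values of the data.
\<close>

lemma particle_scheme_weight:
  fixes \<phi> :: "real^'d \<Rightarrow> real"
  assumes "particle_scheme \<phi> \<rho>0 w"
  obtains W where "0 \<le> W"
    "\<And>h f0 k. 0 < h \<Longrightarrow> bounded (range f0) \<Longrightarrow> \<bar>w h f0 k\<bar> \<le> W * h ^ CARD('d) * linf_norm UNIV f0"
proof -
  have val: "\<bar>f0 x\<bar> \<le> linf_norm UNIV f0" if "bounded (range f0)" for f0 :: "real^'d \<Rightarrow> real" and x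
    using infnorm_le_linf_norm[OF that, of x] by (simp add: infnorm_real_eq_abs)
  from assms show ?thesis
  proof cases
    case (bspline_scheme p a m)
    define S where "S = {l :: int^'d. \<forall>i. \<bar>l $ i\<bar> \<le> int m}"
    show ?thesis
    proof (rule that[of "\<Sum>l\<in>S. \<bar>\<Prod>i\<in>UNIV. a (l $ i)\<bar>"])
      fix h :: real and f0 :: "real^'d \<Rightarrow> real" and k
      assume h: "0 < h" and bd: "bounded (range f0)"
      have "\<bar>\<Sum>l\<in>S. (\<Prod>i\<in>UNIV. a (l $ i)) * f0 (grid h (k + l))\<bar>
          \<le> (\<Sum>l\<in>S. \<bar>\<Prod>i\<in>UNIV. a (l $ i)\<bar> * linf_norm UNIV f0)"
        by (intro order_trans[OF sum_abs] sum_mono)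
           (auto simp: abs_mult intro!: mult_left_mono val[OF bd])
      then have "\<bar>w h f0 k\<bar> \<le> h ^ CARD('d) * (\<Sum>l\<in>S. \<bar>\<Prod>i\<in>UNIV. a (l $ i)\<bar> * linf_norm UNIV f0)"
        using h unfolding bspline_scheme quasi_interp_weight_def S_def[symmetric]
        by (simp add: abs_mult)
      then show "\<bar>w h f0 k\<bar> \<le> (\<Sum>l\<in>S. \<bar>\<Prod>i\<in>UNIV. a (l $ i)\<bar>) * h ^ CARD('d) * linf_norm UNIV f0"
        unfolding sum_distrib_right[symmetric] by (simp only: mult_ac)
    qed (simp add: sum_nonneg)
  next
    case m4_scheme
    show ?thesis
      by (rule that[of 1]) (auto simp: m4_scheme nodal_weight_def abs_mult intro!: mult_left_mono val)
  qed
qed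

section \<open>Counting grid points\<close>

text \<open>
  The estimate of the number of active particles is one-dimensional: the grid points in a cube form a
  product of integer intervals.
\<close>

lemma card_int_interval_le:
  fixes b R :: real
  assumes "0 \<le> R"
  shows "finite {m::int. \<bar>real_of_int m - b\<bar> \<le> R}"
    and "real (card {m::int. \<bar>real_of_int m - b\<bar> \<le> R}) \<le> 2 * R + 1"
proof -
  have eq: "{m::int. \<bar>real_of_int m - b\<bar> \<le> R} = {\<lceil>b - R\<rceil>..\<lfloor>b + R\<rfloor>}"
    by (auto simp: abs_le_iff ceiling_le_iff le_floor_iff)
  show "finite {m::int. \<bar>real_of_int m - b\<bar> \<le> R}"
    unfolding eq by simp
  show "real (card {m::int. \<bar>real_of_int m - b\<bar> \<le> R}) \<le> 2 * R + 1"
    unfolding eq using assms by (cases "\<lceil>b - R\<rceil> \<le> \<lfloor>b + R\<rfloor> + 1") (simp_all, linarith)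
qed

lemma card_grid_points_le:
  fixes z :: "real^'d"
  assumes h: "0 < h" and R: "0 \<le> R"
  defines "S \<equiv> {k :: int^'d. infnorm (z - grid h k) \<le> h * R}"
  shows "finite S" and "real (card S) \<le> (2 * R + 1) ^ CARD('d)"
proof -
  define I where "I = (\<lambda>i. {m::int. \<bar>real_of_int m - z $ i / h\<bar> \<le> R})"
  have "k $ i \<in> I i" if "k \<in> S" for k i
  proof -
    have "\<bar>z $ i - h * real_of_int (k $ i)\<bar> \<le> h * R"
      using component_le_infnorm_cart[of "z - grid h k" i] that by (simp add: S_def grid_def)
    then show ?thesis
      using h by (auto simp: I_def abs_le_iff field_simps)
  qed
  then have sub: "S \<subseteq> vec_lambda ` (PiE UNIV I)"
    by (intro subsetI image_eqI[where x = "vec_nth _"]) auto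
  have finI: "finite (PiE UNIV I)"
    using card_int_interval_le(1)[OF R] by (intro finite_PiE) (auto simp: I_def)
  then show "finite S"
    using sub finite_subset by blast
  have "real (card S) \<le> real (card (PiE UNIV I))"
    using card_mono[OF _ sub] card_image_le[OF finI, of vec_lambda] finI by fastforce
  also have "\<dots> = (\<Prod>i\<in>(UNIV::'d set). real (card (I i)))"
    by (simp add: card_PiE)
  also have "\<dots> \<le> (\<Prod>i\<in>(UNIV::'d set). 2 * R + 1)"
    by (rule prod_mono) (use card_int_interval_le(2)[OF R] in \<open>auto simp: I_def\<close>)
  finally show "real (card S) \<le> (2 * R + 1) ^ CARD('d)" by simp
qed

section \<open>Transport of one particle\<close>

text \<open>
  Everything up to the summation is a statement about one particle. It concerns a single bijection
  with bounded derivatives and a compactly supported Lipschitz shape function.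
\<close>

locale particle_transport =
  fixes F :: "real^'d \<Rightarrow> real^'d" and \<phi> :: "real^'d \<Rightarrow> real" and \<rho>0 L h :: real and r :: nat
  assumes bij: "bij F"
    and order: "1 \<le> r"
    and C1: "cont_diff_map 1 F"
    and inv_C: "cont_diff_map (r + 1) (inv F)"
    and fin_F: "finite_seminorm 1 UNIV F"
    and fin_inv_2: "finite_seminorm 2 UNIV (inv F)"
    and fin_inv: "finite_seminorm (r + 1) UNIV (inv F)"
    and h_pos: "0 < h" and radius_pos: "0 < \<rho>0"
    and shape_supp: "\<And>x. \<phi> x \<noteq> 0 \<Longrightarrow> infnorm x \<le> \<rho>0"
    and shape_lip: "\<And>x y. \<bar>\<phi> x - \<phi> y\<bar> \<le> L * infnorm (x - y)"
    and lip_nonneg: "0 \<le> L"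
begin

lemma inv_F [simp]: "inv F (F x) = x" "F (inv F x) = x"
  using bij by (auto simp: bij_is_inj bij_is_surj surj_f_inv_f)

lemma inv_C_le: "s \<le> r + 1 \<Longrightarrow> cont_diff_map s (inv F)"
  using inv_C cont_diff_antimono unfolding cont_diff_map_def by blast

lemma backward_error_le:
  assumes "1 \<le> s" "s \<le> r" "finite_seminorm (s + 1) UNIV (inv F)"
  shows "infnorm (backward_taylor s F h k x - inv F x)
          \<le> infnorm (x - F (grid h k)) ^ (s + 1) * seminorm (s + 1) UNIV (inv F) / fact (s + 1)"
proof (rule infnorm_cart_leI)
  fix i
  show "\<bar>(backward_taylor s F h k x - inv F x) $ i\<bar>
      \<le> infnorm (x - F (grid h k)) ^ (s + 1) * seminorm (s + 1) UNIV (inv F) / fact (s + 1)"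
    using taylor_remainder_le[OF inv_C_le assms(3), of "F (grid h k)" "x - F (grid h k)" i]
      assms bij backward_taylor_component[OF inv_C_le assms(1), of h k x i]
    by (simp add: abs_minus_commute bij_is_inj)
qed

lemma backward_affine_error_le:
  assumes "infnorm (x - F (grid h k)) \<le> \<delta>"
  shows "infnorm (backward_taylor 1 F h k x - inv F x) \<le> \<delta>^2 * seminorm 2 UNIV (inv F) / 2"
proof -
  have "infnorm (backward_taylor 1 F h k x - inv F x)
      \<le> infnorm (x - F (grid h k)) ^ 2 * seminorm 2 UNIV (inv F) / 2"
    using backward_error_le[of 1 k x] order fin_inv_2 by (simp add: numeral_2_eq_2)
  also have "\<dots> \<le> \<delta>^2 * seminorm 2 UNIV (inv F) / 2"
    using assms
    by (intro divide_right_mono mult_right_mono power_mono seminorm_nonneg fin_inv_2 infnorm_pos_le) auto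
  finally show ?thesis .
qed

lemma F_lipschitz: "infnorm (F y - F x) \<le> seminorm 1 UNIV F * infnorm (y - x)"
  by (rule infnorm_diff_le_seminorm[OF C1 fin_F])

lemma cont_diff_map_differentiable:
  assumes "cont_diff_map 1 f"
  shows "f differentiable (at x)"
  using assms unfolding cont_diff_map_def
  by (subst differentiable_componentwise_within)
     (auto simp: differentiable_on_def Basis_vec_def cart_eq_inner_axis[symmetric])

lemma forward_affine_component:
  "forward_affine F h k y $ i = F (grid h k) $ i + dir_deriv 1 (y - grid h k) (\<lambda>x. F x $ i) (grid h k)"
proof -
  have "(F has_derivative (*v) (jacobian F (at (grid h k)))) (at (grid h k))"
    using cont_diff_map_differentiable[OF C1] by (simp add: jacobian_works)
  then have "((\<lambda>x. F x $ i) has_derivative (\<lambda>v. (jacobian F (at (grid h k)) *v v) $ i)) (at (grid h k))"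
    by (rule bounded_linear.has_derivative[OF bounded_linear_vec_nth])
  from dir_deriv_1[OF this] show ?thesis by (simp add: forward_affine_def)
qed

lemma forward_affine_displacement_le:
  "infnorm (forward_affine F h k y - F (grid h k)) \<le> seminorm 1 UNIV F * infnorm (y - grid h k)"
  by (rule infnorm_cart_leI)
     (use abs_dir_deriv_le[OF fin_F] in \<open>simp add: forward_affine_component mult.commute[of "seminorm _ _ _"]\<close>)

text \<open>
  The linear parts are the derivatives of \<open>F\<close> and of its inverse at corresponding points. By the chain
  rule, applied to both compositions, they are inverse to each other.
\<close>

lemma affine_maps_inverse:
  "backward_taylor 1 F h k (forward_affine F h k y) = y"
  "forward_affine F h k (backward_taylor 1 F h k x) = x"
proof -
  define a b where "a = grid h k" and "b = F a"
  define D where "D = frechet_derivative F (at a)"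
  define E where "E = frechet_derivative (inv F) (at b)"
  have D: "(F has_derivative D) (at a)"
    using cont_diff_map_differentiable[OF C1] frechet_derivative_works D_def by blast
  have E: "(inv F has_derivative E) (at b)"
    using cont_diff_map_differentiable[OF inv_C_le[of 1]] frechet_derivative_works E_def by auto
  have "((\<lambda>x. inv F (F x)) has_derivative (\<lambda>x. E (D x))) (at a)"
    using diff_chain_at[OF D, of "inv F" E] E by (simp add: o_def b_def)
  then have ED: "E (D v) = v" for v
    using has_derivative_unique[OF _ has_derivative_ident[of "at a"]] by (simp, metis)
  have "((\<lambda>x. F (inv F x)) has_derivative (\<lambda>x. D (E x))) (at b)"
    using diff_chain_at[OF E, of F D] D by (simp add: o_def b_def)
  then have DE: "D (E v) = v" for v
    using has_derivative_unique[OF _ has_derivative_ident[of "at b"]] by (simp, metis)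
  have fwd: "forward_affine F h k y = b + D (y - a)" for y
    using dir_deriv_1[OF bounded_linear.has_derivative[OF bounded_linear_vec_nth D]]
    by (simp add: vec_eq_iff forward_affine_component a_def b_def)
  have bwd: "backward_taylor 1 F h k x = a + E (x - b)" for x
    using dir_deriv_1[OF bounded_linear.has_derivative[OF bounded_linear_vec_nth E]] bij
      backward_taylor_component[OF inv_C_le[of 1], of h k x]
    by (simp add: vec_eq_iff bij_is_inj a_def b_def dir_deriv_0)
  show "backward_taylor 1 F h k (forward_affine F h k y) = y"
    "forward_affine F h k (backward_taylor 1 F h k x) = x"
    unfolding fwd bwd by (simp_all add: ED DE)
qed

lemma particle_nonzero_infnorm_le:
  assumes "particle \<phi> h k y \<noteq> 0"
  shows "infnorm (y - grid h k) \<le> h * \<rho>0"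
proof -
  have "infnorm ((1 / h) *\<^sub>R (y - grid h k)) \<le> \<rho>0"
    using assms by (intro shape_supp) (auto simp: particle_def)
  then show ?thesis
    using h_pos unfolding infnorm_mul by (simp add: field_simps)
qed

lemma particle_supp_infnorm_le:
  assumes "y \<in> particle_supp \<phi> h k"
  shows "infnorm (y - grid h k) \<le> h * \<rho>0"
proof -
  have "particle_supp \<phi> h k \<subseteq> linf_cball (grid h k) (h * \<rho>0)"
    unfolding particle_supp_def
    by (rule closure_minimal[OF _ closed_linf_cball])
       (auto simp: linf_cball_def particle_nonzero_infnorm_le)
  then show ?thesis using assms by (auto simp: linf_cball_def)
qed

text \<open>
  Makes the supremum in the local radius finite, and at the same time bounds it.
\<close>

lemma affine_error_on_supp_le:
  assumes "x \<in> F ` particle_supp \<phi> h k"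
  shows "infnorm (backward_taylor 1 F h k x - inv F x)
          \<le> (seminorm 1 UNIV F * (h * \<rho>0))^2 * seminorm 2 UNIV (inv F) / 2"
proof (rule backward_affine_error_le)
  obtain y where y: "x = F y" "y \<in> particle_supp \<phi> h k" using assms by auto
  have "infnorm (F y - F (grid h k)) \<le> seminorm 1 UNIV F * infnorm (y - grid h k)"
    by (rule F_lipschitz)
  also have "\<dots> \<le> seminorm 1 UNIV F * (h * \<rho>0)"
    by (intro mult_left_mono particle_supp_infnorm_le y seminorm_nonneg fin_F)
  finally show "infnorm (x - F (grid h k)) \<le> seminorm 1 UNIV F * (h * \<rho>0)"
    by (simp add: y)
qed

text \<open>
  The supremum over an empty support would be an unspecified real number, hence the hypothesis.
\<close>

lemma local_radius_le_global_radius: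
  assumes "particle_supp \<phi> h k \<noteq> {}"
  shows "local_radius \<phi> \<rho>0 F h k \<le> global_radius \<rho>0 F h"
proof -
  have "linf_norm (F ` particle_supp \<phi> h k) (\<lambda>x. backward_taylor 1 F h k x - inv F x)
      \<le> (seminorm 1 UNIV F * (h * \<rho>0))^2 * seminorm 2 UNIV (inv F) / 2"
    unfolding linf_norm_def by (rule cSUP_least) (use assms affine_error_on_supp_le in auto)
  then have "local_radius \<phi> \<rho>0 F h k
      \<le> \<rho>0 + 1 / h * ((seminorm 1 UNIV F * (h * \<rho>0))^2 * seminorm 2 UNIV (inv F) / 2)"
    unfolding local_radius_def using h_pos by (intro add_left_mono mult_left_mono) auto
  also have "\<dots> = global_radius \<rho>0 F h"
    using h_pos by (simp add: global_radius_def field_simps power2_eq_square)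
  finally show ?thesis .
qed

text \<open>
  Why cutting off outside the a priori support does no harm: its radius is the radius of the particle
  plus the largest error of the affine backward map on the image of the particle's support, so every
  point of that image is captured.
\<close>

lemma exact_particle_in_apriori_supp:
  assumes "particle \<phi> h k (inv F x) \<noteq> 0"
  shows "x \<in> apriori_supp \<phi> \<rho>0 F h k"
proof -
  let ?e = "\<lambda>x. backward_taylor 1 F h k x - inv F x"
  let ?K = "F ` particle_supp \<phi> h k"
  have "inv F x \<in> particle_supp \<phi> h k"
    unfolding particle_supp_def using assms closure_subset by fastforce
  then have x: "x \<in> ?K" by (metis image_eqI inv_F(2))
  have "infnorm (?e x) \<le> linf_norm ?K ?e"
    unfolding linf_norm_def
    by (rule cSUP_upper[OF x]) (rule bdd_aboveI2, rule affine_error_on_supp_le)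
  moreover have "infnorm (inv F x - grid h k) \<le> h * \<rho>0"
    by (rule particle_nonzero_infnorm_le[OF assms])
  moreover have "infnorm (?e x + (inv F x - grid h k)) \<le> infnorm (?e x) + infnorm (inv F x - grid h k)"
    by (rule infnorm_triangle)
  ultimately have "infnorm (backward_taylor 1 F h k x - grid h k) \<le> h * local_radius \<phi> \<rho>0 F h k"
    using h_pos by (simp add: local_radius_def algebra_simps)
  then show ?thesis
    unfolding apriori_supp_def linf_cball_def
    by (metis (mono_tags, lifting) affine_maps_inverse(2) image_eqI mem_Collect_eq)
qed

lemma apriori_supp_bounds:
  assumes "x \<in> apriori_supp \<phi> \<rho>0 F h k" "particle_supp \<phi> h k \<noteq> {}"
  shows "infnorm (x - F (grid h k)) \<le> h * (global_radius \<rho>0 F h * seminorm 1 UNIV F)"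
    and "infnorm (backward_taylor 1 F h k x - grid h k) \<le> h * global_radius \<rho>0 F h"
proof -
  obtain y where y: "x = forward_affine F h k y"
    and "infnorm (y - grid h k) \<le> h * local_radius \<phi> \<rho>0 F h k"
    using assms(1) by (auto simp: apriori_supp_def linf_cball_def)
  moreover have "h * local_radius \<phi> \<rho>0 F h k \<le> h * global_radius \<rho>0 F h"
    using h_pos local_radius_le_global_radius[OF assms(2)] by simp
  ultimately have d: "infnorm (y - grid h k) \<le> h * global_radius \<rho>0 F h"
    by simp
  then show "infnorm (backward_taylor 1 F h k x - grid h k) \<le> h * global_radius \<rho>0 F h"
    by (simp only: y affine_maps_inverse)
  have "infnorm (x - F (grid h k)) \<le> seminorm 1 UNIV F * infnorm (y - grid h k)"
    unfolding y by (rule forward_affine_displacement_le)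
  also have "\<dots> \<le> seminorm 1 UNIV F * (h * global_radius \<rho>0 F h)"
    by (intro mult_left_mono d seminorm_nonneg fin_F)
  finally show "infnorm (x - F (grid h k)) \<le> h * (global_radius \<rho>0 F h * seminorm 1 UNIV F)"
    by (simp add: mult_ac)
qed

lemma radius_le_global_radius: "\<rho>0 \<le> global_radius \<rho>0 F h"
  unfolding global_radius_def
  using radius_pos h_pos seminorm_nonneg[OF fin_inv_2] by simp

lemma c_flow_nonneg:
  assumes "finite_seminorm (s + 1) UNIV (inv F)"
  shows "0 \<le> c_flow s \<rho>0 F h"
  unfolding c_flow_def
  using radius_le_global_radius radius_pos seminorm_nonneg[OF fin_F] seminorm_nonneg[OF assms]
  by (intro mult_nonneg_nonneg zero_le_power) auto

lemma c_flow_1_nonneg: "0 \<le> c_flow 1 \<rho>0 F h"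
  using c_flow_nonneg[of 1] fin_inv_2 by (simp add: numeral_2_eq_2)

text \<open>
  The excess of the global radius over \<open>\<rho>0\<close> is, up to replacing \<open>\<rho>0\<close> by the larger global radius, half of
  \<open>h\<close> times the flow constant of order one. This is how the flow constant controls the number of
  active particles.
\<close>

lemma global_radius_le: "global_radius \<rho>0 F h \<le> \<rho>0 + h / 2 * c_flow 1 \<rho>0 F h"
proof -
  have "global_radius \<rho>0 F h = \<rho>0 + h / 2 * ((\<rho>0 * seminorm 1 UNIV F)^2 * seminorm 2 UNIV (inv F))"
    by (simp add: global_radius_def algebra_simps power2_eq_square)
  also have "\<dots> \<le> \<rho>0 + h / 2 * ((global_radius \<rho>0 F h * seminorm 1 UNIV F)^2 * seminorm 2 UNIV (inv F))"
    using h_pos radius_pos radius_le_global_radius seminorm_nonneg[OF fin_F] seminorm_nonneg[OF fin_inv_2]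
    by (intro add_left_mono mult_left_mono mult_right_mono power_mono mult_nonneg_nonneg) auto
  finally show ?thesis by (simp add: c_flow_def numeral_2_eq_2)
qed

text \<open>
  The affine backward map sends the a priori support into a cube around \<open>x\<^sub>k\<close>, and its distance to the
  exact backward map is a Taylor remainder. Each of the two steps costs half of the term with the
  flow constant.
\<close>

lemma apriori_supp_near_preimage:
  assumes "x \<in> apriori_supp \<phi> \<rho>0 F h k" "particle_supp \<phi> h k \<noteq> {}"
  shows "infnorm (inv F x - grid h k) \<le> h * (\<rho>0 + h * c_flow 1 \<rho>0 F h)"
proof -
  have "infnorm (backward_taylor 1 F h k x - inv F x) \<le> h * (h / 2 * c_flow 1 \<rho>0 F h)"
    using backward_affine_error_le[OF apriori_supp_bounds(1)[OF assms]]
    by (simp add: c_flow_def power_mult_distrib power2_eq_square mult_ac numeral_2_eq_2)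
  moreover have "infnorm (backward_taylor 1 F h k x - grid h k) \<le> h * (\<rho>0 + h / 2 * c_flow 1 \<rho>0 F h)"
    using apriori_supp_bounds(2)[OF assms] global_radius_le h_pos
    by (meson mult_left_mono less_imp_le order_trans)
  moreover have "infnorm (inv F x - grid h k)
      \<le> infnorm (inv F x - backward_taylor 1 F h k x) + infnorm (backward_taylor 1 F h k x - grid h k)"
    using infnorm_triangle[of "inv F x - backward_taylor 1 F h k x" "backward_taylor 1 F h k x - grid h k"]
    by simp
  ultimately show ?thesis
    by (simp add: infnorm_sub algebra_simps)
qed

text \<open>
  Whichever of the two transported particles is nonzero, the same support conditions hold, so one
  finite set of indices serves both sums.
\<close>

lemma active_particle:
  assumes "transported_particle r \<phi> \<rho>0 F h k x \<noteq> 0 \<or> particle \<phi> h k (inv F x) \<noteq> 0"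
  shows "x \<in> apriori_supp \<phi> \<rho>0 F h k" "particle_supp \<phi> h k \<noteq> {}"
proof -
  show "x \<in> apriori_supp \<phi> \<rho>0 F h k"
    using assms exact_particle_in_apriori_supp
    by (auto simp: transported_particle_def indicator_def split: if_splits)
  obtain y where "particle \<phi> h k y \<noteq> 0"
    using assms by (auto simp: transported_particle_def)
  then show "particle_supp \<phi> h k \<noteq> {}"
    unfolding particle_supp_def using closure_subset by fastforce
qed

lemma particle_lipschitz:
  "\<bar>particle \<phi> h k y - particle \<phi> h k z\<bar> \<le> L * infnorm (y - z) / h / h ^ CARD('d)"
proof -
  have "\<bar>\<phi> ((1 / h) *\<^sub>R (y - grid h k)) - \<phi> ((1 / h) *\<^sub>R (z - grid h k))\<bar> \<le> L * infnorm ((1 / h) *\<^sub>R (y - z))"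
    using shape_lip[of "(1 / h) *\<^sub>R (y - grid h k)" "(1 / h) *\<^sub>R (z - grid h k)"]
    by (simp add: scaleR_diff_right[symmetric] del: scaleR_diff_right)
  then have "\<bar>\<phi> ((1 / h) *\<^sub>R (y - grid h k)) - \<phi> ((1 / h) *\<^sub>R (z - grid h k))\<bar> \<le> L * infnorm (y - z) / h"
    using h_pos by (simp add: infnorm_mul)
  then show ?thesis
    unfolding particle_def diff_divide_distrib[symmetric] abs_divide
    using h_pos by (subst abs_of_nonneg[of "h ^ CARD('d)"]) (auto intro: divide_right_mono simp del: divide_divide_eq_left)
qed

text \<open>
  Inside the a priori support the error is that of the argument of a Lipschitz function; where both
  terms vanish there is nothing to estimate. Bounding the factorial in the Taylor remainder below by
  one leaves exactly the flow constant.
\<close>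

lemma single_particle_error_le:
  "\<bar>transported_particle r \<phi> \<rho>0 F h k x - particle \<phi> h k (inv F x)\<bar>
     \<le> L * (h ^ r * c_flow r \<rho>0 F h) / h ^ CARD('d)"
proof (cases "transported_particle r \<phi> \<rho>0 F h k x \<noteq> 0 \<or> particle \<phi> h k (inv F x) \<noteq> 0")
  case True
  note act = active_particle[OF True]
  have sn: "0 \<le> seminorm (r + 1) UNIV (inv F)" by (rule seminorm_nonneg[OF fin_inv])
  have "infnorm (backward_taylor r F h k x - inv F x)
      \<le> infnorm (x - F (grid h k)) ^ (r + 1) * seminorm (r + 1) UNIV (inv F) / fact (r + 1)"
    using order fin_inv by (intro backward_error_le) auto
  also have "\<dots> \<le> infnorm (x - F (grid h k)) ^ (r + 1) * seminorm (r + 1) UNIV (inv F) / 1"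
    using sn infnorm_pos_le[of "x - F (grid h k)"] fact_ge_1[of "r + 1", where 'a = real]
    by (intro divide_left_mono mult_nonneg_nonneg zero_le_power) auto
  also have "\<dots> \<le> (h * (global_radius \<rho>0 F h * seminorm 1 UNIV F)) ^ (r + 1) * seminorm (r + 1) UNIV (inv F) / 1"
    by (intro divide_right_mono mult_right_mono power_mono apriori_supp_bounds act sn infnorm_pos_le) auto
  also have "\<dots> = h * (h ^ r * c_flow r \<rho>0 F h)"
    by (simp add: c_flow_def power_mult_distrib)
  finally have e: "infnorm (backward_taylor r F h k x - inv F x) / h \<le> h ^ r * c_flow r \<rho>0 F h"
    using h_pos by (simp add: field_simps)
  have "\<bar>particle \<phi> h k (backward_taylor r F h k x) - particle \<phi> h k (inv F x)\<bar>
     \<le> L * (infnorm (backward_taylor r F h k x - inv F x) / h) / h ^ CARD('d)"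
    using particle_lipschitz by simp
  also have "\<dots> \<le> L * (h ^ r * c_flow r \<rho>0 F h) / h ^ CARD('d)"
    using e h_pos lip_nonneg by (intro divide_right_mono mult_left_mono) auto
  finally show ?thesis
    using act by (simp add: transported_particle_def)
next
  case False
  then show ?thesis
    using lip_nonneg h_pos c_flow_nonneg[OF fin_inv] by simp
qed

section \<open>Summation over the particles\<close>

lemma transport_error_le:
  fixes W M :: real
  assumes W: "\<And>k. \<bar>w h f0 k\<bar> \<le> W * h ^ CARD('d) * M" and "0 \<le> W * M"
  shows "\<bar>transport_error r \<phi> \<rho>0 w F h f0 x\<bar>
    \<le> W * L * (2 * \<rho>0 + 3) ^ CARD('d) * h ^ r * c_flow r \<rho>0 F h * (1 + h * c_flow 1 \<rho>0 F h) ^ CARD('d) * M"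
proof -
  \<comment> \<open>Up to the factor \<open>h\<close>, the distance to \<open>inv F x\<close> within which all active grid points lie.\<close>
  define R where "R = \<rho>0 + h * c_flow 1 \<rho>0 F h"
  define S where "S = {k :: int^'d. infnorm (inv F x - grid h k) \<le> h * R}"
  define Q where "Q = L * (h ^ r * c_flow r \<rho>0 F h)"
  let ?t = "\<lambda>k. transported_particle r \<phi> \<rho>0 F h k x"
  let ?e = "\<lambda>k. particle \<phi> h k (inv F x)"
  have R0: "0 \<le> R"
    using radius_pos h_pos c_flow_1_nonneg by (simp add: R_def)
  have Q0: "0 \<le> Q"
    using lip_nonneg h_pos c_flow_nonneg[OF fin_inv] by (simp add: Q_def)
  have finS: "finite S" and cardS: "real (card S) \<le> (2 * R + 1) ^ CARD('d)"
    unfolding S_def by (rule card_grid_points_le[OF h_pos R0])+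
  have outside: "?t k = 0" "?e k = 0" if "k \<notin> S" for k
    using that active_particle[of k x] apriori_supp_near_preimage[of x k]
    unfolding S_def R_def by blast+
  have "(\<Sum>\<^sub>\<infinity>k\<in>UNIV. w h f0 k * ?t k) = (\<Sum>k\<in>S. w h f0 k * ?t k)"
    "(\<Sum>\<^sub>\<infinity>k\<in>UNIV. w h f0 k * ?e k) = (\<Sum>k\<in>S. w h f0 k * ?e k)"
    using outside finS by (auto intro!: infsumI has_sum_finite_neutralI)
  then have "transport_error r \<phi> \<rho>0 w F h f0 x = (\<Sum>k\<in>S. w h f0 k * (?t k - ?e k))"
    by (simp add: transport_error_def particle_sum_def exact_transport_def approx_op_def
        sum_subtractf algebra_simps)
  also have "\<bar>\<dots>\<bar> \<le> (\<Sum>k\<in>S. W * h ^ CARD('d) * M * (Q / h ^ CARD('d)))"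
  proof (intro order_trans[OF sum_abs] sum_mono)
    fix k
    show "\<bar>w h f0 k * (?t k - ?e k)\<bar> \<le> W * h ^ CARD('d) * M * (Q / h ^ CARD('d))"
      unfolding abs_mult Q_def
      by (rule mult_mono[OF W single_particle_error_le]) (use order_trans[OF abs_ge_zero W] in auto)
  qed
  also have "\<dots> = W * M * Q * real (card S)"
    using h_pos by simp
  also have "\<dots> \<le> W * M * Q * ((2 * \<rho>0 + 3) * (1 + h * c_flow 1 \<rho>0 F h)) ^ CARD('d)"
  proof (rule mult_left_mono)
    have "2 * R + 1 \<le> (2 * \<rho>0 + 3) * (1 + h * c_flow 1 \<rho>0 F h)"
      using radius_pos h_pos c_flow_1_nonneg by (simp add: R_def algebra_simps)
    then show "real (card S) \<le> ((2 * \<rho>0 + 3) * (1 + h * c_flow 1 \<rho>0 F h)) ^ CARD('d)"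
      using R0 by (intro order_trans[OF cardS] power_mono) auto
  qed (use assms Q0 in simp)
  finally show ?thesis
    by (simp add: Q_def power_mult_distrib mult_ac)
qed

end

section \<open>The characteristic flow and the error estimate\<close>

text \<open>
  A characteristic may be restarted at any of its points. Two characteristics that meet at time \<open>t\<close>
  therefore agree at time zero, and following backwards the characteristic through a given point at
  time \<open>t\<close> produces its preimage.
\<close>

lemma bij_flow:
  assumes adm: "admissible_velocity T u" and t: "t \<in> {0..T}"
  shows "bij (flow u T 0 t)"
proof -
  have T0: "0 \<in> {0..T}" using t by auto
  have ex: "\<exists>X. characteristic u T s x X" if "s \<in> {0..T}" for s x
    using adm that unfolding admissible_velocity_def by blast
  have uniq: "X \<tau> = Y \<tau>"
    if "s \<in> {0..T}" "characteristic u T s x X" "characteristic u T s x Y" "\<tau> \<in> {0..T}" for s x X Y \<tau>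
    using adm that unfolding admissible_velocity_def by blast
  have restart: "characteristic u T s (X s) X"
    if "characteristic u T s' x X" for s s' x X
    using that by (simp add: characteristic_def)
  define X where "X = (\<lambda>x. SOME X. characteristic u T 0 x X)"
  have X: "characteristic u T 0 x (X x)" for x
    unfolding X_def by (rule someI_ex[OF ex[OF T0]])
  have X0: "X x 0 = x" for x using X[of x] by (simp add: characteristic_def)
  have fl: "flow u T 0 t x = X x t" for x
    by (simp add: flow_def X_def)
  show ?thesis
  proof (rule bijI)
    show "inj (flow u T 0 t)"
    proof (rule injI)
      fix x y assume "flow u T 0 t x = flow u T 0 t y"
      then have "characteristic u T t (X x t) (X y)"
        using restart[OF X, of t y] by (simp add: fl)
      then have "X x 0 = X y 0"
        using uniq[OF t restart[OF X] _ T0] by blast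
      then show "x = y" by (simp add: X0)
    qed
    show "surj (flow u T 0 t)"
      unfolding surj_def
    proof
      fix z
      obtain Y where Y: "characteristic u T t z Y"
        using ex[OF t] by blast
      have "X (Y 0) t = Y t"
        by (rule uniq[OF T0 X restart[OF Y] t])
      also have "Y t = z"
        using Y by (simp add: characteristic_def)
      finally show "\<exists>x. z = flow u T 0 t x"
        unfolding fl by blast
    qed
  qed
qed

theorem theorem2:
  fixes \<phi> :: "real^'d \<Rightarrow> real" and \<rho>0 :: real
    and w :: "real \<Rightarrow> (real^'d \<Rightarrow> real) \<Rightarrow> int^'d \<Rightarrow> real" and r :: nat
  assumes "particle_scheme \<phi> \<rho>0 w" and "1 \<le> r"
  shows "\<exists>C::real. \<forall>(T::real) (\<Delta>t::real) (u :: real \<Rightarrow> real^'d \<Rightarrow> real^'d) (n::nat) (h::real)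
           (f0 :: real^'d \<Rightarrow> real) (F :: real^'d \<Rightarrow> real^'d).
           0 < T \<longrightarrow> 0 < \<Delta>t \<longrightarrow> real n * \<Delta>t \<le> T \<longrightarrow>
           admissible_velocity T u \<longrightarrow>
           F = flow u T 0 (real n * \<Delta>t) \<longrightarrow>
           cont_diff_map 1 F \<longrightarrow> cont_diff_map (r + 1) (inv F) \<longrightarrow>
           finite_seminorm 1 UNIV F \<longrightarrow>
           finite_seminorm 2 UNIV (inv F) \<longrightarrow>
           finite_seminorm (r + 1) UNIV (inv F) \<longrightarrow>
           0 < h \<longrightarrow> bounded (range f0) \<longrightarrow>
           bounded (range (transport_error r \<phi> \<rho>0 w F h f0)) \<and>
           linf_norm UNIV (transport_error r \<phi> \<rho>0 w F h f0)
             \<le> C * h ^ r * c_flow r \<rho>0 F h * (1 + h * c_flow 1 \<rho>0 F h) ^ CARD('d)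
                 * linf_norm UNIV f0"
proof -
  obtain L where shape: "0 < \<rho>0" "0 \<le> L" "\<And>x. \<phi> x \<noteq> 0 \<Longrightarrow> infnorm x \<le> \<rho>0"
    "\<And>x y. \<bar>\<phi> x - \<phi> y\<bar> \<le> L * infnorm (x - y)"
    using particle_scheme_shape[OF assms(1)] by blast
  obtain W where W: "0 \<le> W"
    "\<And>h f0 k. 0 < h \<Longrightarrow> bounded (range f0) \<Longrightarrow> \<bar>w h f0 k\<bar> \<le> W * h ^ CARD('d) * linf_norm UNIV f0"
    using particle_scheme_weight[OF assms(1)] by blast
  show ?thesis
  proof (intro exI[of _ "W * L * (2 * \<rho>0 + 3) ^ CARD('d)"] allI impI)
    fix T \<Delta>t h :: real and u :: "real \<Rightarrow> real^'d \<Rightarrow> real^'d" and n :: nat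
      and f0 :: "real^'d \<Rightarrow> real" and F :: "real^'d \<Rightarrow> real^'d"
    assume T: "0 < T" "0 < \<Delta>t" "real n * \<Delta>t \<le> T" "admissible_velocity T u"
      and F: "F = flow u T 0 (real n * \<Delta>t)"
      and reg: "cont_diff_map 1 F" "cont_diff_map (r + 1) (inv F)" "finite_seminorm 1 UNIV F"
        "finite_seminorm 2 UNIV (inv F)" "finite_seminorm (r + 1) UNIV (inv F)"
      and h: "0 < h" and bd: "bounded (range f0)"
    have "bij F"
      unfolding F by (rule bij_flow) (use T in auto)
    then interpret particle_transport F \<phi> \<rho>0 L h r
      using assms(2) reg h shape by unfold_locales auto
    let ?err = "transport_error r \<phi> \<rho>0 w F h f0"
    let ?bound = "W * L * (2 * \<rho>0 + 3) ^ CARD('d) * h ^ r * c_flow r \<rho>0 F h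
        * (1 + h * c_flow 1 \<rho>0 F h) ^ CARD('d) * linf_norm UNIV f0"
    have pointwise: "\<bar>?err x\<bar> \<le> ?bound" for x
      by (rule transport_error_le) (use W h bd linf_norm_nonneg[OF bd] in auto)
    then have "bounded (range ?err)"
      unfolding bounded_iff by auto
    moreover have "linf_norm UNIV ?err \<le> ?bound"
      unfolding linf_norm_def[of UNIV ?err]
      by (rule cSUP_least) (use pointwise in \<open>simp_all add: infnorm_real_eq_abs\<close>)
    ultimately show "bounded (range ?err) \<and> linf_norm UNIV ?err \<le> ?bound" ..
  qed
qed

end
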